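(* The set of four vertices of the unit square in $\mathbb{R}^2$ is Jackson in $\mathbb{R}^2$. More generally, for every real $x>0$ such that $x^2$ is a rational number, the set of four vertices of a rectangle in $\mathbb{R}^2$ with height $x$ and width $1$ is Jackson in $\mathbb{R}^2$.
   Context: An isometric copy of a set $X\subseteq\mathbb{R}^2$ is a set $Y\subseteq\mathbb{R}^2$ that is the image of $X$ under an isometry of $\mathbb{R}^2$ (reflections allowed). A set $S\subseteq\mathbb{R}^2$ is a Steinhaus set for $X$ in $\mathbb{R}^2$ if $|Y\cap S|=1$ for every isometric copy $Y$ of $X$ in $\mathbb{R}^2$. The set $X$ is Jackson in $\mathbb{R}^2$ if there is no Steinhaus set for $X$ in $\mathbb{R}^2$, i.e. for every $S\subseteq\mathbb{R}^2$ there is an isometric copy $Y$ of $X$ with $|Y\cap S|\neq 1$. *)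

theory Defs
  imports "HOL-Analysis.Analysis"
begin

text \<open>Surjectivity is automatic for distance-preserving self-maps of the plane.\<close>

definition isometry_plane :: "(real ^ 2 \<Rightarrow> real ^ 2) \<Rightarrow> bool" where
  "isometry_plane f \<longleftrightarrow> (\<forall>a b. dist (f a) (f b) = dist a b)"

definition isometric_copy :: "(real ^ 2) set \<Rightarrow> (real ^ 2) set \<Rightarrow> bool" where
  "isometric_copy X Y \<longleftrightarrow> (\<exists>f. isometry_plane f \<and> Y = f ` X)"

text \<open>Since \<^term>\<open>card\<close> is 0 on infinite sets, \<open>card A = 1\<close> holds exactly for singletons.\<close>

definition steinhaus_set :: "(real ^ 2) set \<Rightarrow> (real ^ 2) set \<Rightarrow> bool" where
  "steinhaus_set X S \<longleftrightarrow> (\<forall>Y. isometric_copy X Y \<longrightarrow> card (Y \<inter> S) = 1)"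

definition jackson :: "(real ^ 2) set \<Rightarrow> bool" where
  "jackson X \<longleftrightarrow> \<not> (\<exists>S. steinhaus_set X S)"

definition unit_square_vertices :: "(real ^ 2) set" where
  "unit_square_vertices = {vector [0, 0], vector [1, 0], vector [1, 1], vector [0, 1]}"

text \<open>The vertex sets of all rectangles with side lengths \<open>w\<close> and \<open>h\<close>, in any position.\<close>

definition rectangle_vertices :: "real \<Rightarrow> real \<Rightarrow> (real ^ 2) set \<Rightarrow> bool" where
  "rectangle_vertices w h X \<longleftrightarrow>
     (\<exists>p u v. orthogonal u v \<and> norm u = w \<and> norm v = h \<and> X = {p, p + u, p + u + v, p + v})"

end

theory Submission
  imports Defs
begin

text \<open>
  Suppose that \<open>S\<close> meets every rectangle with sides \<open>w\<close> and \<open>h\<close> in exactly one point.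
  Tile the plane by such rectangles and look at the indicator \<open>f i j\<close> of \<open>S\<close> at the grid points:
  the four values around each cell add up to 1. Hence the sums over vertical edges alternate
  between two values along a row of cells, and this has two consequences. First, two points of
  \<open>S\<close> never lie at distance an odd multiple of \<open>w\<close> or of \<open>h\<close> (\<open>odd_multiple_not_distance\<close>).
  Second, if \<open>p\<close> belongs to \<open>S\<close> and \<open>u\<close>, \<open>v\<close> are the sides of a rectangle, then \<open>S\<close> contains
  all points \<open>p + 2 k u\<close>, or all points \<open>p + 2 k v\<close>, with natural \<open>k\<close>
  (\<open>even_ray_dichotomy\<close>).

  Fix \<open>p\<close> in \<open>S\<close>. Let \<open>C\<close> and \<open>D\<close> be the sets of unit vectors \<open>z\<close> such that \<open>S\<close> contains all
  points \<open>p + 2 k w z\<close>, respectively all points \<open>p + 2 k h z\<close>. Write \<open>J\<close> for the quarter turn and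
  \<open>R\<close> for the rotation by the angle with cosine \<open>7/8\<close>. Then \<open>2 z\<close> and \<open>2 R z\<close> are at distance 1,
  so \<open>C\<close> never contains both \<open>z\<close> and \<open>R z\<close>, and neither does \<open>D\<close>; and by the dichotomy
  \<open>y \<in> C\<close> or \<open>z \<in> D\<close> whenever \<open>y\<close> and \<open>z\<close> are orthogonal. If \<open>z \<in> C\<close>, then successively \<open>R z \<notin> C\<close>, \<open>J R z \<in> D\<close>,
  \<open>J R R z \<notin> D\<close> and \<open>- R R z \<in> C\<close>. But \<open>z + R R z = (7/4) R z\<close>, so that \<open>4 z\<close> and \<open>- 4 R R z\<close>
  are at distance 7, which is odd. So \<open>C\<close> is empty, whence \<open>D\<close> consists of all unit vectors;
  this contradicts the fact that \<open>D\<close> never contains both \<open>z\<close> and \<open>R z\<close>.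
\<close>

section \<open>Grids whose cells all have sum one\<close>

definition unit_cell_sums :: "(nat \<Rightarrow> nat \<Rightarrow> int) \<Rightarrow> bool" where
  "unit_cell_sums f \<longleftrightarrow>
     (\<forall>i j. f i j + f (Suc i) j + f i (Suc j) + f (Suc i) (Suc j) = 1)"

lemma edge_sum_even:
  assumes "unit_cell_sums f"
  shows "f (2 * i) j + f (2 * i) (Suc j) = f 0 j + f 0 (Suc j)"
proof (induction i)
  case (Suc i)
  have "f (2*i) j + f (Suc (2*i)) j + f (2*i) (Suc j) + f (Suc (2*i)) (Suc j) = 1"
    and "f (Suc (2*i)) j + f (Suc (Suc (2*i))) j
           + f (Suc (2*i)) (Suc j) + f (Suc (Suc (2*i))) (Suc j) = 1"
    using assms unfolding unit_cell_sums_def by blast+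
  with Suc show ?case by simp
qed simp

lemma edge_sum_odd:
  assumes "unit_cell_sums f"
  shows "f (Suc (2 * i)) j + f (Suc (2 * i)) (Suc j) = 1 - (f 0 j + f 0 (Suc j))"
proof -
  have "f (2*i) j + f (Suc (2*i)) j + f (2*i) (Suc j) + f (Suc (2*i)) (Suc j) = 1"
    using assms unfolding unit_cell_sums_def by blast
  with edge_sum_even[OF assms, of i j] show ?thesis by simp
qed

text \<open>By \<open>edge_sum_even\<close>, the difference of the columns \<open>2 i\<close> and \<open>0\<close> changes its sign from each
  row to the next, so it has the same value in all even rows.\<close>

lemma even_column_difference:
  assumes "unit_cell_sums f"
  shows "f (2 * i) (2 * j) - f 0 (2 * j) = f (2 * i) 0 - f 0 0"
proof (induction j)
  case (Suc j)
  show ?case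
    using Suc edge_sum_even[OF assms, of i "2*j"] edge_sum_even[OF assms, of i "Suc (2*j)"]
    by simp
qed simp

section \<open>Rotations of the plane\<close>

definition quarter_turn :: "real ^ 2 \<Rightarrow> real ^ 2" where
  "quarter_turn z = vector [- z $ 2, z $ 1]"

text \<open>The angle \<open>\<theta>\<close> with \<open>cos \<theta> = 7/8\<close> makes two distances odd at once: the vectors \<open>2 z\<close>
  and \<open>2 z'\<close> at angle \<open>\<theta>\<close> are at distance \<open>\<bar>z\<bar> sqrt (8 - 8 cos \<theta>) = \<bar>z\<bar>\<close>, and the vectors
  \<open>4 z\<close> and \<open>- 4 z'\<close>, where \<open>z'\<close> is at angle \<open>2 \<theta>\<close> from \<open>z\<close>, are at distance
  \<open>8 \<bar>z\<bar> cos \<theta> = 7 \<bar>z\<bar>\<close>.\<close>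

definition rotation :: "real ^ 2 \<Rightarrow> real ^ 2" where
  "rotation z = (7/8) *\<^sub>R z + (sqrt 15 / 8) *\<^sub>R quarter_turn z"

lemma inner_plane: "x \<bullet> y = x $ 1 * y $ 1 + x $ 2 * y $ (2::2)" for x y :: "real ^ 2"
  by (simp add: inner_vec_def sum_2)

lemma quarter_turn_scaleR: "quarter_turn (c *\<^sub>R z) = c *\<^sub>R quarter_turn z"
  by (simp add: quarter_turn_def vec_eq_iff forall_2)

lemma orthogonal_quarter_turn: "orthogonal z (quarter_turn z)"
  by (simp add: orthogonal_def quarter_turn_def inner_plane)

lemma norm_quarter_turn: "norm (quarter_turn z) = norm z"
  by (simp add: norm_eq_sqrt_inner quarter_turn_def inner_plane)

lemma norm_combination_quarter_turn:
  "norm (a *\<^sub>R z + b *\<^sub>R quarter_turn z) = sqrt (a\<^sup>2 + b\<^sup>2) * norm z"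
proof -
  have "(norm (a *\<^sub>R z + b *\<^sub>R quarter_turn z))\<^sup>2 = (a\<^sup>2 + b\<^sup>2) * (norm z)\<^sup>2"
    unfolding power2_norm_eq_inner inner_plane
    by (simp add: quarter_turn_def power2_eq_square algebra_simps)
  then show ?thesis
    by - (rule power2_eq_imp_eq, simp_all add: power_mult_distrib)
qed

lemma norm_rotation: "norm (rotation z) = norm z"
  unfolding rotation_def norm_combination_quarter_turn by (simp add: power_divide)

lemma rotation_quarter_turn: "rotation (quarter_turn z) = quarter_turn (rotation z)"
  by (simp add: rotation_def quarter_turn_def vec_eq_iff forall_2)

lemma rotation_scaleR: "rotation (c *\<^sub>R z) = c *\<^sub>R rotation z"
  by (simp add: rotation_def quarter_turn_scaleR algebra_simps)

lemma dist_double_rotation: "dist (2 *\<^sub>R z) (2 *\<^sub>R rotation z) = norm z"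
proof -
  have "2 *\<^sub>R z - 2 *\<^sub>R rotation z = (1/4) *\<^sub>R z + (- sqrt 15 / 4) *\<^sub>R quarter_turn z"
    by (simp add: rotation_def vec_eq_iff forall_2 algebra_simps)
  then show ?thesis
    unfolding dist_norm by (simp only: norm_combination_quarter_turn) (simp add: power_divide)
qed

text \<open>The characteristic equation \<open>R R + 1 = 2 cos \<theta> R\<close> of the rotation by \<open>\<theta>\<close>.\<close>

lemma rotation_rotation: "z + rotation (rotation z) = (7/4) *\<^sub>R rotation z"
  by (simp add: rotation_def quarter_turn_def vec_eq_iff forall_2 field_simps)

lemma dist_quadruple_rotation_rotation:
  "dist (4 *\<^sub>R z) (4 *\<^sub>R - rotation (rotation z)) = 7 * norm z"
proof -
  have "4 *\<^sub>R z - 4 *\<^sub>R - rotation (rotation z) = 4 *\<^sub>R (z + rotation (rotation z))"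
    by (simp add: algebra_simps)
  then show ?thesis
    by (simp add: dist_norm rotation_rotation norm_rotation)
qed

section \<open>Sets meeting every rectangle in one point\<close>

definition meets_rectangles_once :: "real \<Rightarrow> real \<Rightarrow> (real ^ 2) set \<Rightarrow> bool" where
  "meets_rectangles_once w h S \<longleftrightarrow>
     (\<forall>Y. rectangle_vertices w h Y \<longrightarrow> card (Y \<inter> S) = 1)"

lemma rectangle_vertices_swap: "rectangle_vertices w h Y \<Longrightarrow> rectangle_vertices h w Y"
proof -
  assume "rectangle_vertices w h Y"
  then obtain p u v where "orthogonal u v" "norm u = w" "norm v = h"
    "Y = {p, p + u, p + u + v, p + v}"
    unfolding rectangle_vertices_def by blast
  then show ?thesis
    unfolding rectangle_vertices_def
    by (intro exI[of _ p] exI[of _ v] exI[of _ u])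
       (auto simp: orthogonal_commute add.assoc add.commute)
qed

lemma meets_rectangles_once_swap:
  "meets_rectangles_once w h S \<Longrightarrow> meets_rectangles_once h w S"
  unfolding meets_rectangles_once_def using rectangle_vertices_swap by blast

lemma card_Int_four:
  assumes "a \<noteq> b" "a \<noteq> c" "a \<noteq> d" "b \<noteq> c" "b \<noteq> d" "c \<noteq> d"
  shows "int (card ({a, b, c, d} \<inter> S))
    = of_bool (a \<in> S) + of_bool (b \<in> S) + of_bool (d \<in> S) + of_bool (c \<in> S)"
  using assms by (simp add: Int_insert_left)

lemma unit_cell_sums_indicator:
  fixes q u v :: "real ^ 2"
  assumes S: "meets_rectangles_once w h S" and "0 < w" "0 < h"
    and uv: "orthogonal u v" "norm u = w" "norm v = h"
  shows "unit_cell_sums (\<lambda>i j. of_bool (q + real i *\<^sub>R u + real j *\<^sub>R v \<in> S))"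
proof -
  have "u \<noteq> 0" "v \<noteq> 0" using assms by auto
  moreover have "u + v \<noteq> 0" "u \<noteq> v"
    using uv \<open>u \<noteq> 0\<close> unfolding orthogonal_def
    by (auto simp: add_eq_0_iff)
  ultimately have sum: "of_bool (p \<in> S) + of_bool (p + u \<in> S) + of_bool (p + v \<in> S)
      + of_bool (p + u + v \<in> S) = (1::int)" for p
  proof -
    have "card ({p, p + u, p + u + v, p + v} \<inter> S) = 1"
      using S uv unfolding meets_rectangles_once_def rectangle_vertices_def by blast
    moreover have "p \<noteq> p + u" "p \<noteq> p + u + v" "p \<noteq> p + v" "p + u \<noteq> p + u + v" "p + u \<noteq> p + v"
      "p + u + v \<noteq> p + v"
      using \<open>u \<noteq> 0\<close> \<open>v \<noteq> 0\<close> \<open>u + v \<noteq> 0\<close> \<open>u \<noteq> v\<close> by (auto simp: add.assoc)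
    ultimately show ?thesis using card_Int_four[of p "p + u" "p + u + v" "p + v" S] by simp
  qed
  show ?thesis
    unfolding unit_cell_sums_def
  proof (intro allI)
    fix i j
    show "of_bool (q + real i *\<^sub>R u + real j *\<^sub>R v \<in> S)
        + of_bool (q + real (Suc i) *\<^sub>R u + real j *\<^sub>R v \<in> S)
        + of_bool (q + real i *\<^sub>R u + real (Suc j) *\<^sub>R v \<in> S)
        + of_bool (q + real (Suc i) *\<^sub>R u + real (Suc j) *\<^sub>R v \<in> S) = (1::int)"
      using sum[of "q + real i *\<^sub>R u + real j *\<^sub>R v"] by (simp add: algebra_simps)
  qed
qed

text \<open>Lay the grid along the two points: the vertical edge at the first point already has
  sum at least 1, so by \<open>edge_sum_odd\<close> the edges of that row in odd columns have sum 0.\<close>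

lemma odd_multiple_not_distance:
  assumes S: "meets_rectangles_once w h S" and pos: "0 < w" "0 < h"
    and "q \<in> S" "r \<in> S"
  shows "dist q r \<noteq> real (Suc (2 * k)) * w"
proof
  assume d: "dist q r = real (Suc (2 * k)) * w"
  define u where "u = (1 / real (Suc (2 * k))) *\<^sub>R (r - q)"
  define v where "v = (h / w) *\<^sub>R quarter_turn u"
  define f :: "nat \<Rightarrow> nat \<Rightarrow> int"
    where "f i j = of_bool (q + real i *\<^sub>R u + real j *\<^sub>R v \<in> S)" for i j
  have "norm u = w"
    using d by (simp add: u_def dist_norm norm_minus_commute)
  moreover have "norm v = h"
    using \<open>norm u = w\<close> pos by (simp add: v_def norm_quarter_turn)
  moreover have "orthogonal u v"
    using orthogonal_quarter_turn[of u] by (simp add: v_def orthogonal_def)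
  ultimately have "unit_cell_sums f"
    unfolding f_def using unit_cell_sums_indicator[OF S pos] by blast
  from edge_sum_odd[OF this, of k 0]
  have "f (Suc (2 * k)) 0 + f (Suc (2 * k)) 1 = 1 - (f 0 0 + f 0 1)" by simp
  moreover have "f 0 0 = 1" using \<open>q \<in> S\<close> by (simp add: f_def)
  moreover have "f (Suc (2 * k)) 0 = 1"
  proof -
    have "q + real (Suc (2 * k)) *\<^sub>R u = r"
      unfolding u_def by (simp del: of_nat_Suc)
    then show ?thesis using \<open>r \<in> S\<close> by (simp add: f_def del: of_nat_Suc)
  qed
  moreover have "f 0 1 \<ge> 0" "f (Suc (2 * k)) 1 \<ge> 0" by (simp_all add: f_def)
  ultimately show False by linarith
qed

definition contains_even_ray :: "(real ^ 2) set \<Rightarrow> real ^ 2 \<Rightarrow> real ^ 2 \<Rightarrow> bool" where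
  "contains_even_ray S p u \<longleftrightarrow> (\<forall>k::nat. p + real (2 * k) *\<^sub>R u \<in> S)"

text \<open>If \<open>S\<close> misses \<open>p + 2 j v\<close>, then in row \<open>2 j\<close> the indicator is at least as large in every even
  column as in column 0. By \<open>even_column_difference\<close> the same holds in row 0, where column 0 has
  the value 1.\<close>

lemma even_ray_dichotomy:
  assumes S: "meets_rectangles_once w h S" and pos: "0 < w" "0 < h"
    and uv: "orthogonal u v" "norm u = w" "norm v = h" and "p \<in> S"
  shows "contains_even_ray S p u \<or> contains_even_ray S p v"
proof (rule disjCI)
  assume "\<not> contains_even_ray S p v"
  then obtain j where j: "p + real (2 * j) *\<^sub>R v \<notin> S"
    unfolding contains_even_ray_def by blast
  define f :: "nat \<Rightarrow> nat \<Rightarrow> int"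
    where "f i j = of_bool (p + real i *\<^sub>R u + real j *\<^sub>R v \<in> S)" for i j
  have f: "unit_cell_sums f"
    unfolding f_def using unit_cell_sums_indicator[OF S pos uv] .
  show "contains_even_ray S p u"
    unfolding contains_even_ray_def
  proof
    fix i
    have "f (2 * i) (2 * j) - f 0 (2 * j) = f (2 * i) 0 - f 0 0"
      by (rule even_column_difference[OF f])
    moreover have "f 0 (2 * j) = 0" "f 0 0 = 1" "f (2 * i) (2 * j) \<ge> 0"
      using j \<open>p \<in> S\<close> by (simp_all add: f_def)
    ultimately have "f (2 * i) 0 \<noteq> 0" by linarith
    then show "p + real (2 * i) *\<^sub>R u \<in> S" by (simp add: f_def split: if_splits)
  qed
qed

lemma no_even_rays_along_rotation:
  assumes S: "meets_rectangles_once w h S" and pos: "0 < w" "0 < h" and "norm z = w"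
    and rays: "contains_even_ray S p z" "contains_even_ray S p (rotation z)"
  shows False
proof -
  have "p + 2 *\<^sub>R z \<in> S" "p + 2 *\<^sub>R rotation z \<in> S"
    using rays[unfolded contains_even_ray_def, THEN spec[of _ 1]] by simp_all
  from odd_multiple_not_distance[OF S pos this, of 0] show False
    using dist_double_rotation[of z] \<open>norm z = w\<close> by simp
qed

lemma no_even_rays_along_minus_rotation_rotation:
  assumes S: "meets_rectangles_once w h S" and pos: "0 < w" "0 < h" and "norm z = w"
    and rays: "contains_even_ray S p z" "contains_even_ray S p (- rotation (rotation z))"
  shows False
proof -
  have "p + 4 *\<^sub>R z \<in> S" "p + 4 *\<^sub>R - rotation (rotation z) \<in> S"
    using rays[unfolded contains_even_ray_def, THEN spec[of _ 2]] by simp_all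
  from odd_multiple_not_distance[OF S pos this, of 3] show False
    unfolding dist_add_cancel dist_quadruple_rotation_rotation by (simp add: \<open>norm z = w\<close>)
qed

theorem not_meets_rectangles_once:
  assumes pos: "0 < w" "0 < h"
  shows "\<not> meets_rectangles_once w h S"
proof
  assume S: "meets_rectangles_once w h S"
  note S' = meets_rectangles_once_swap[OF S]
  define e :: "real ^ 2" where "e = axis 1 1"
  have e: "norm e = 1" by (simp add: e_def)
  obtain p where p: "p \<in> S"
  proof -
    have "rectangle_vertices w h
        {0, 0 + w *\<^sub>R e, 0 + w *\<^sub>R e + h *\<^sub>R quarter_turn e, 0 + h *\<^sub>R quarter_turn e}"
      unfolding rectangle_vertices_def
      using pos e orthogonal_quarter_turn[of e]
      by (intro exI[of _ 0] exI[of _ "w *\<^sub>R e"] exI[of _ "h *\<^sub>R quarter_turn e"])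
         (simp add: norm_quarter_turn orthogonal_def)
    then have "card ({0, 0 + w *\<^sub>R e, 0 + w *\<^sub>R e + h *\<^sub>R quarter_turn e,
        0 + h *\<^sub>R quarter_turn e} \<inter> S) = 1"
      using S unfolding meets_rectangles_once_def by blast
    then have "S \<noteq> {}" by auto
    with that show ?thesis by blast
  qed
  define C where "C z \<longleftrightarrow> contains_even_ray S p (w *\<^sub>R z)" for z
  define D where "D z \<longleftrightarrow> contains_even_ray S p (h *\<^sub>R z)" for z
  have C_rotation: "\<not> C (rotation z)" if "norm z = 1" "C z" for z
    using no_even_rays_along_rotation[OF S pos, of "w *\<^sub>R z" p] that pos
    by (auto simp: C_def rotation_scaleR)
  have D_rotation: "\<not> D (rotation z)" if "norm z = 1" "D z" for z
    using no_even_rays_along_rotation[OF S' pos(2,1), of "h *\<^sub>R z" p] that pos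
    by (auto simp: D_def rotation_scaleR)
  have C_or_D: "C y \<or> D z" if "norm y = 1" "norm z = 1" "orthogonal y z" for y z
    using even_ray_dichotomy[OF S pos, of "w *\<^sub>R y" "h *\<^sub>R z" p] that pos p
    by (simp add: C_def D_def orthogonal_def)
  have not_C: "\<not> C z" if z: "norm z = 1" for z
  proof
    assume "C z"
    then have "\<not> C (rotation z)" using z C_rotation by blast
    then have "D (quarter_turn (rotation z))"
      using C_or_D[of "rotation z" "quarter_turn (rotation z)"] z orthogonal_quarter_turn
      by (simp add: norm_rotation norm_quarter_turn)
    then have "\<not> D (rotation (quarter_turn (rotation z)))"
      using z by (intro D_rotation) (simp_all add: norm_rotation norm_quarter_turn)
    moreover have "orthogonal (- rotation (rotation z)) (rotation (quarter_turn (rotation z)))"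
      using orthogonal_quarter_turn[of "rotation (rotation z)"]
      by (simp add: rotation_quarter_turn orthogonal_def)
    ultimately have "C (- rotation (rotation z))"
      using C_or_D[of "- rotation (rotation z)" "rotation (quarter_turn (rotation z))"] z
      by (simp add: norm_rotation norm_quarter_turn)
    then show False
      using no_even_rays_along_minus_rotation_rotation[OF S pos, of "w *\<^sub>R z" p] \<open>C z\<close> z pos
      by (simp add: C_def rotation_scaleR)
  qed
  have D_all: "D z" if "norm z = 1" for z
    using C_or_D[of "quarter_turn z" z] not_C[of "quarter_turn z"] that
      orthogonal_quarter_turn[of z]
    by (simp add: norm_quarter_turn orthogonal_commute)
  from D_rotation[OF e D_all[OF e]] D_all[of "rotation e"] e show False
    by (simp add: norm_rotation)
qed

section \<open>Congruence of rectangles with equal sides\<close>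

lemma parseval_plane:
  fixes a b z :: "real ^ 2"
  assumes "norm a = 1" "norm b = 1" "orthogonal a b"
  shows "(z \<bullet> a)\<^sup>2 + (z \<bullet> b)\<^sup>2 = (norm z)\<^sup>2"
proof -
  have "a $ 1 * a $ 1 + a $ 2 * a $ 2 = 1" "b $ 1 * b $ 1 + b $ 2 * b $ 2 = 1"
    "a $ 1 * b $ 1 + a $ 2 * b $ 2 = 0"
    using assms by (simp_all add: norm_eq_1 orthogonal_def inner_plane)
  then show ?thesis
    unfolding power2_norm_eq_inner inner_plane by algebra
qed

lemma norm_orthonormal_combination:
  fixes a b :: "'a::real_inner"
  assumes "norm a = 1" "norm b = 1" "orthogonal a b"
  shows "(norm (s *\<^sub>R a + t *\<^sub>R b))\<^sup>2 = s\<^sup>2 + t\<^sup>2"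
  using assms norm_add_Pythagorean[of "s *\<^sub>R a" "t *\<^sub>R b"] by (simp add: orthogonal_def)

text \<open>The isometry maps the frame of unit side vectors of \<open>X\<close> at one vertex to that of \<open>Y\<close>;
  it may reverse the orientation.\<close>

lemma isometric_copy_rectangle:
  assumes pos: "0 < w" "0 < h" and "rectangle_vertices w h X" "rectangle_vertices w h Y"
  shows "isometric_copy X Y"
proof -
  obtain p u v where X: "orthogonal u v" "norm u = w" "norm v = h"
    "X = {p, p + u, p + u + v, p + v}"
    using assms(3) unfolding rectangle_vertices_def by blast
  obtain q u' v' where Y: "orthogonal u' v'" "norm u' = w" "norm v' = h"
    "Y = {q, q + u', q + u' + v', q + v'}"
    using assms(4) unfolding rectangle_vertices_def by blast
  define a b a' b' where ab: "a = (1/w) *\<^sub>R u" "b = (1/h) *\<^sub>R v"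
    "a' = (1/w) *\<^sub>R u'" "b' = (1/h) *\<^sub>R v'"
  have on: "norm a = 1" "norm b = 1" "orthogonal a b"
    and on': "norm a' = 1" "norm b' = 1" "orthogonal a' b'"
    using X Y pos by (simp_all add: ab orthogonal_def)
  define L where "L z = (z \<bullet> a) *\<^sub>R a' + (z \<bullet> b) *\<^sub>R b'" for z
  have L_diff: "L (x - y) = L x - L y" and L_add: "L (x + y) = L x + L y" for x y
    by (simp_all add: L_def algebra_simps)
  have L_norm: "norm (L z) = norm z" for z
    using norm_orthonormal_combination[OF on'] parseval_plane[OF on]
    by - (rule power2_eq_imp_eq, simp_all add: L_def)
  have "isometry_plane (\<lambda>z. q + L (z - p))"
    unfolding isometry_plane_def
    by (simp add: dist_norm L_norm flip: L_diff)
  moreover have "L u = u'" "L v = v'" "L 0 = 0"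
    using X Y pos
    by (simp_all add: L_def ab orthogonal_def inner_commute[of v u] power2_norm_eq_inner[symmetric]
        dot_square_norm power2_eq_square)
  then have "Y = (\<lambda>z. q + L (z - p)) ` X"
    unfolding X Y by (simp add: L_add algebra_simps)
  ultimately show ?thesis
    unfolding isometric_copy_def by blast
qed

lemma jackson_rectangle:
  assumes "0 < w" "0 < h" "rectangle_vertices w h X"
  shows "jackson X"
  using isometric_copy_rectangle[OF assms] not_meets_rectangles_once[OF assms(1,2)]
  unfolding jackson_def steinhaus_set_def meets_rectangles_once_def by blast

lemma rectangle_vertices_unit_square: "rectangle_vertices 1 1 unit_square_vertices"
proof -
  define u v :: "real ^ 2" where "u = vector [1, 0]" and "v = vector [0, 1]"
  have "orthogonal u v" "norm u = 1" "norm v = 1"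
    by (simp_all add: u_def v_def orthogonal_def inner_plane norm_eq_1)
  moreover have "vector [0, 0] = (0 :: real ^ 2)" "vector [1, 0] = 0 + u"
    "vector [1, 1] = 0 + u + v" "vector [0, 1] = 0 + v"
    by (simp_all add: u_def v_def vec_eq_iff forall_2)
  ultimately show ?thesis
    unfolding rectangle_vertices_def unit_square_vertices_def by metis
qed

theorem proposition3p4:
  shows "jackson unit_square_vertices \<and>
    (\<forall>x::real. x > 0 \<and> x^2 \<in> \<rat> \<longrightarrow>
       (\<forall>X. rectangle_vertices 1 x X \<longrightarrow> jackson X))"
  using jackson_rectangle[OF _ _ rectangle_vertices_unit_square] jackson_rectangle[of 1]
  by auto

end
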